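(* Let $A,N_1,\dots,N_m\in\mathbb{R}^{n\times n}$, $B\in\mathbb{R}^{n\times m}$, $C\in\mathbb{R}^{p\times n}$, and let $k>0$, $T>0$ be constants such that $$\sigma\Big(I_n\otimes (A+\tfrac{k^2}{2} I_n)+(A+\tfrac{k^2}{2} I_n)\otimes I_n+\sum_{i=1}^m N_i\otimes N_i\Big)\subset \mathbb{C}_-.$$ Let $Q\in\mathbb{R}^{n\times n}$ be the (unique, symmetric positive semidefinite) solution of $$(A+\tfrac{k^2}{2} I_n)^T Q+Q (A+\tfrac{k^2}{2} I_n)+\sum_{i=1}^m N_i^T Q N_i = -C^T C.$$ Let $x_0\in\mathbb{R}^n$, let $u=(u_1,\dots,u_m)^T$ be a control with $\|u(t)\|_2\le k$ for $t\in[0,T]$, let $x(t,x_0,u)$ denote the solution of $$\frac{dx(t)}{dt}=Ax(t)+Bu(t)+\sum_{i=1}^m N_i x(t)u_i(t),\quad x(0)=x_0,$$ and let $y(t,x_0,u)=Cx(t,x_0,u)$. Then $$\int_0^T \|y(s,x_0,u)\|_2^2\,ds\leq x_0^TQx_0+2\int_0^T x(s,x_0,u)^T Q B u(s)\,ds.$$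
   Context: $\|\cdot\|_2$ is the Euclidean norm. Controls $u$ are (measurable) functions with $\int_0^T\|u(t)\|_2^2\,dt<\infty$. $\sigma(\cdot)$ denotes the spectrum, $\mathbb{C}_-$ the open left half-plane, $\otimes$ the Kronecker product. The matrix $Q$ is called the type II observability Gramian; under the stated spectral condition the equation defining $Q$ has a unique solution, which is positive semidefinite. *)

theory Defs
  imports "HOL-Analysis.Analysis"
begin

definition kronecker ::
    "'a::times ^ 'n ^ 'm \<Rightarrow> 'a ^ 'q ^ 'p \<Rightarrow> 'a ^ ('n \<times> 'q) ^ ('m \<times> 'p)"
    (infixl "\<otimes>\<^sub>K" 70)
  where "A \<otimes>\<^sub>K B = (\<chi> r c. A $ fst r $ fst c * B $ snd r $ snd c)"

text \<open>The spectrum of a real matrix is the set of its complex eigenvalues.\<close>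

definition spectrum :: "real ^ 'n ^ 'n \<Rightarrow> complex set"
  where "spectrum M =
    {\<mu>. \<exists>v :: complex ^ 'n. v \<noteq> 0 \<and> map_matrix complex_of_real M *v v = \<mu> *s v}"

text \<open>The class of square-integrable controls on \<open>[0, T]\<close>.\<close>

definition is_control :: "real \<Rightarrow> (real \<Rightarrow> real ^ 'm) \<Rightarrow> bool"
  where "is_control T u \<longleftrightarrow>
    set_borel_measurable lebesgue {0..T} u \<and>
    set_integrable lebesgue {0..T} (\<lambda>t. (norm (u t))\<^sup>2)"

text \<open>Absolute continuity in the sense of real analysis; the library constant
  \<open>absolutely_continuous\<close> is the unrelated notion for measures. A division \<open>d\<close> is a finite family
  of compact intervals \<open>K = {Inf K..Sup K}\<close> with pairwise disjoint interiors.\<close>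

definition abs_cont_on :: "real set \<Rightarrow> (real \<Rightarrow> 'a::real_normed_vector) \<Rightarrow> bool"
  where "abs_cont_on S f \<longleftrightarrow>
    (\<forall>\<epsilon>>0. \<exists>\<delta>>0. \<forall>d. d division_of \<Union>d \<and> \<Union>d \<subseteq> S \<and> (\<Sum>K\<in>d. Sup K - Inf K) < \<delta> \<longrightarrow>
       (\<Sum>K\<in>d. norm (f (Sup K) - f (Inf K))) < \<epsilon>)"

text \<open>Controls are only measurable, so solutions are meant in the sense of Caratheodory:
  absolutely continuous and satisfying the differential equation almost everywhere.\<close>

definition bilinear_solution ::
    "real ^ 'n ^ 'n \<Rightarrow> ('m \<Rightarrow> real ^ 'n ^ 'n) \<Rightarrow> real ^ 'm ^ 'n \<Rightarrow>
     real \<Rightarrow> real ^ 'n \<Rightarrow> (real \<Rightarrow> real ^ 'm) \<Rightarrow> (real \<Rightarrow> real ^ 'n) \<Rightarrow> bool"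
  where "bilinear_solution A N B T x0 u x \<longleftrightarrow>
    x 0 = x0 \<and> abs_cont_on {0..T} x \<and>
    (AE t in lebesgue. t \<in> {0..T} \<longrightarrow>
       (x has_vector_derivative
          (A *v x t + B *v u t + (\<Sum>i\<in>UNIV. (u t $ i) *\<^sub>R (N i *v x t))))
         (at t within {0..T}))"

end

theory Submission
  imports Defs
begin

text \<open>Along a solution, \<open>V(t) = x(t)\<^sup>T Q x(t)\<close> satisfies
  \<open>V' \<le> - \<parallel>C x\<parallel>\<^sup>2 + 2 x\<^sup>T Q B u\<close> almost everywhere: completing squares bounds
  \<open>2 u\<^sub>i x\<^sup>T Q N\<^sub>i x\<close> by \<open>u\<^sub>i\<^sup>2 x\<^sup>T Q x + (N\<^sub>i x)\<^sup>T Q (N\<^sub>i x)\<close>, and the shift by \<open>k\<^sup>2/2\<close> in the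
  Gramian equation absorbs \<open>\<parallel>u\<parallel>\<^sup>2 x\<^sup>T Q x\<close>. Integrating over \<open>[0, T]\<close> and dropping \<open>V(T) \<ge> 0\<close>
  gives the claim. Positivity of \<open>Q\<close> only uses that the Kronecker matrix has no real eigenvalue in
  \<open>[0, \<infinity>)\<close>: this makes every operator \<open>(1 - \<theta>) I - \<theta> L\<close>, \<open>0 \<le> \<theta> \<le> 1\<close>, invertible, where \<open>L\<close> is the
  generalized Lyapunov operator, and a continuation in \<open>\<theta>\<close> transports positivity from \<open>I\<close> to \<open>- L\<close>.\<close>

subsection \<open>Absolutely continuous functions\<close>

lemma abs_cont_onE:
  assumes "abs_cont_on S f" "e > 0"
  obtains \<delta> where "\<delta> > 0"
    "\<And>d. \<lbrakk>d division_of \<Union>d; \<Union>d \<subseteq> S; (\<Sum>K\<in>d. Sup K - Inf K) < \<delta>\<rbrakk>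
      \<Longrightarrow> (\<Sum>K\<in>d. norm (f (Sup K) - f (Inf K))) < e"
proof -
  from assms have "\<exists>\<delta>>0. \<forall>d. d division_of \<Union>d \<and> \<Union>d \<subseteq> S \<and> (\<Sum>K\<in>d. Sup K - Inf K) < \<delta> \<longrightarrow>
      (\<Sum>K\<in>d. norm (f (Sup K) - f (Inf K))) < e"
    unfolding abs_cont_on_def by simp
  then show ?thesis by (elim exE conjE) (rule that, assumption, simp)
qed

text \<open>The increments of \<open>g\<close> over a division are at most \<open>L\<close> times
  those of \<open>f\<close>, so a \<open>\<delta>\<close> chosen for \<open>f\<close> also serves
  \<open>g\<close>. In this way absolute continuity passes from a solution to its quadratic
  form.\<close>

lemma abs_cont_on_dominated:
  fixes f :: "real \<Rightarrow> 'a::real_normed_vector" and g :: "real \<Rightarrow> 'b::real_normed_vector"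
  assumes f: "abs_cont_on S f" and L: "L \<ge> 0"
    and le: "\<And>s t. \<lbrakk>s \<in> S; t \<in> S\<rbrakk> \<Longrightarrow> norm (g t - g s) \<le> L * norm (f t - f s)"
  shows "abs_cont_on S g"
  unfolding abs_cont_on_def
proof (intro allI impI)
  fix e :: real assume "e > 0"
  \<comment> \<open>Dividing by \<open>L + 1\<close> instead of \<open>L\<close> covers
    \<open>L = 0\<close> and keeps the final bound strict.\<close>
  then have "e / (L + 1) > 0" using L by simp
  then obtain \<delta> where "\<delta> > 0" and \<delta>: "\<And>d. \<lbrakk>d division_of \<Union>d; \<Union>d \<subseteq> S; (\<Sum>K\<in>d. Sup K - Inf K) < \<delta>\<rbrakk>
      \<Longrightarrow> (\<Sum>K\<in>d. norm (f (Sup K) - f (Inf K))) < e / (L + 1)"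
    by (rule abs_cont_onE[OF f]) (rule that, assumption+)
  show "\<exists>\<delta>>0. \<forall>d. d division_of \<Union>d \<and> \<Union>d \<subseteq> S \<and> (\<Sum>K\<in>d. Sup K - Inf K) < \<delta> \<longrightarrow>
       (\<Sum>K\<in>d. norm (g (Sup K) - g (Inf K))) < e"
  proof (intro exI conjI allI impI)
    fix d assume d: "d division_of \<Union>d \<and> \<Union>d \<subseteq> S \<and> (\<Sum>K\<in>d. Sup K - Inf K) < \<delta>"
    have ends: "Sup K \<in> S \<and> Inf K \<in> S" if "K \<in> d" for K
    proof -
      obtain a b where K: "K = cbox a b" and "K \<noteq> {}"
        using division_ofD(3,4)[of d "\<Union>d" K] d \<open>K \<in> d\<close> by blast
      then have "Sup K = b" "Inf K = a" "a \<in> K" "b \<in> K" by auto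
      then show ?thesis using d \<open>K \<in> d\<close> by auto
    qed
    have "(\<Sum>K\<in>d. norm (g (Sup K) - g (Inf K))) \<le> (\<Sum>K\<in>d. L * norm (f (Sup K) - f (Inf K)))"
      by (intro sum_mono le) (use ends in auto)
    also have "\<dots> = L * (\<Sum>K\<in>d. norm (f (Sup K) - f (Inf K)))"
      by (simp add: sum_distrib_left)
    also have "\<dots> \<le> L * (e / (L + 1))"
      using \<delta>[of d] d L by (intro mult_left_mono) auto
    also have "\<dots> < e" using L \<open>e > 0\<close> by (simp add: field_simps)
    finally show "(\<Sum>K\<in>d. norm (g (Sup K) - g (Inf K))) < e" .
  qed (use \<open>\<delta> > 0\<close> in auto)
qed

text \<open>A division consisting of a single interval turns the defining estimate into continuity,
  with a \<open>\<delta>\<close> independent of the point.\<close>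

lemma abs_cont_on_imp_continuous_on:
  fixes f :: "real \<Rightarrow> 'a::real_normed_vector"
  assumes f: "abs_cont_on {a..b} f"
  shows "continuous_on {a..b} f"
  unfolding continuous_on_iff
proof (intro ballI allI impI)
  fix s e :: real assume s: "s \<in> {a..b}" and "e > 0"
  obtain \<delta> where "\<delta> > 0" and \<delta>: "\<And>d. \<lbrakk>d division_of \<Union>d; \<Union>d \<subseteq> {a..b}; (\<Sum>K\<in>d. Sup K - Inf K) < \<delta>\<rbrakk>
      \<Longrightarrow> (\<Sum>K\<in>d. norm (f (Sup K) - f (Inf K))) < e"
    by (rule abs_cont_onE[OF f \<open>e > 0\<close>]) (rule that, assumption+)
  have *: "norm (f v - f u) < e" if "u \<le> v" "u \<in> {a..b}" "v \<in> {a..b}" "v - u < \<delta>" for u v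
    using \<delta>[of "{cbox u v}"] that division_of_self[of u v] by auto
  show "\<exists>d>0. \<forall>t\<in>{a..b}. dist t s < d \<longrightarrow> dist (f t) (f s) < e"
  proof (intro exI conjI ballI impI)
    fix t assume "t \<in> {a..b}" "dist t s < \<delta>"
    then show "dist (f t) (f s) < e"
      using *[of s t] *[of t s] s by (cases "s \<le> t") (auto simp: dist_norm norm_minus_commute)
  qed (rule \<open>\<delta> > 0\<close>)
qed

text \<open>The gauge is chosen pointwise by differentiability off the null set \<open>E\<close>, and inside an open
  superset of \<open>E\<close> of small measure on \<open>E\<close>; absolute continuity controls the second kind of tags.\<close>

theorem fundamental_theorem_of_calculus_abs_cont:
  fixes f :: "real \<Rightarrow> 'a::banach"
  assumes "a \<le> b" and ac: "abs_cont_on {a..b} f"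
    and deriv: "AE t in lebesgue. t \<in> {a..b} \<longrightarrow> (f has_vector_derivative f' t) (at t within {a..b})"
  shows "(f' has_integral (f b - f a)) {a..b}"
proof -
  obtain E where E: "E \<in> null_sets lebesgue"
    and derE: "\<And>t. \<lbrakk>t \<in> {a..b}; t \<notin> E\<rbrakk> \<Longrightarrow> (f has_vector_derivative f' t) (at t within {a..b})"
    using deriv by (elim AE_E3) auto
  \<comment> \<open>Zeroing the derivative on the null set \<open>E\<close> leaves the integral
    unchanged, and a tag in \<open>E\<close> then contributes only the increment of \<open>f\<close>
    over its interval.\<close>
  define g where "g t = (if t \<in> E then 0 else f' t)" for t
  have "(g has_integral (f b - f a)) {a..b}"
    unfolding has_integral_real
  proof (intro allI impI)
    fix e :: real assume "e > 0"
    \<comment> \<open>The differentiability errors will add up to \<open>e1 * (b - a)\<close>, which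
      has to stay within \<open>e / 2\<close>; the summand 1 covers \<open>a = b\<close>.\<close>
    define e1 where "e1 = e / (2 * (b - a + 1))"
    have e1: "e1 > 0" "e1 * (b - a) \<le> e / 2"
      using \<open>e > 0\<close> \<open>a \<le> b\<close> by (auto simp: e1_def field_simps)
    obtain \<delta> where "\<delta> > 0" and \<delta>: "\<And>d. \<lbrakk>d division_of \<Union>d; \<Union>d \<subseteq> {a..b}; (\<Sum>K\<in>d. Sup K - Inf K) < \<delta>\<rbrakk>
        \<Longrightarrow> (\<Sum>K\<in>d. norm (f (Sup K) - f (Inf K))) < e / 2"
      by (rule abs_cont_onE[OF ac half_gt_zero[OF \<open>e > 0\<close>]]) (rule that, assumption+)
    obtain U where U: "open U" "E \<subseteq> U" "(U - E) \<in> lmeasurable" "emeasure lebesgue (U - E) < ennreal \<delta>"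
      using sets_lebesgue_outer_open[of E \<delta>] E \<open>\<delta> > 0\<close> by auto
    have "emeasure lebesgue U = emeasure lebesgue (U - E)"
      using emeasure_Diff_null_set[OF E, of U] U(1) by simp
    then have Ul: "emeasure lebesgue U < ennreal \<delta>" using U by simp
    then have "emeasure lebesgue U < \<infinity>"
      using ennreal_less_top order_less_trans by (fastforce simp: infinity_ennreal_def)
    then have Um: "U \<in> lmeasurable"
      using U(1) by (intro fmeasurableI) auto
    then have Um2: "measure lebesgue U < \<delta>"
      using Ul \<open>\<delta> > 0\<close> emeasure_eq_measure2[OF Um] by (simp add: ennreal_less_iff)
    have "\<exists>d>0. (t \<in> E \<longrightarrow> ball t d \<subseteq> U) \<and> (t \<in> {a..b} - E \<longrightarrow>
         (\<forall>y\<in>{a..b}. norm (y-t) < d \<longrightarrow> norm (f y - f t - (y-t) *\<^sub>R f' t) \<le> e1 * norm (y-t)))" for t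
    proof (cases "t \<in> E")
      case True
      with U show ?thesis using open_contains_ball by (metis DiffE subset_iff)
    next
      case False
      then show ?thesis
        using derE[of t] e1(1) unfolding has_vector_derivative_def has_derivative_within_alt
        by (cases "t \<in> {a..b}") (auto intro: exI[of _ 1])
    qed
    then obtain d where d: "\<And>t. d t > 0" and dE: "\<And>t. t \<in> E \<Longrightarrow> ball t (d t) \<subseteq> U"
      and dd: "\<And>t y. \<lbrakk>t \<in> {a..b}; t \<notin> E; y \<in> {a..b}; norm (y-t) < d t\<rbrakk>
          \<Longrightarrow> norm (f y - f t - (y-t) *\<^sub>R f' t) \<le> e1 * norm (y-t)"
      by (metis DiffI)
    show "\<exists>\<gamma>. gauge \<gamma> \<and> (\<forall>p. p tagged_division_of {a..b} \<and> \<gamma> fine p \<longrightarrow>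
        norm ((\<Sum>(t,K)\<in>p. measure lborel K *\<^sub>R g t) - (f b - f a)) < e)"
    proof (intro exI conjI allI impI)
      show "gauge (\<lambda>t. ball t (d t))" using d gauge_ball_dependent by blast
    next
      fix p assume p: "p tagged_division_of {a..b} \<and> (\<lambda>t. ball t (d t)) fine p"
      then have ptag: "p tagged_division_of {a..b}" and fine: "(\<lambda>t. ball t (d t)) fine p" by auto
      have fin: "finite p" using ptag by blast
      define D where "D = (\<lambda>(t,K). measure lborel K *\<^sub>R g t - (f (Sup K) - f (Inf K)))"
      define pE where "pE = {z\<in>p. fst z \<in> E}"
      have int: "\<exists>u v. K = {u..v} \<and> u \<le> t \<and> t \<le> v \<and> a \<le> u \<and> v \<le> b \<and> Inf K = u \<and> Sup K = v
          \<and> measure lborel K = v - u \<and> {u..v} \<subseteq> ball t (d t)"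
        if tK: "(t,K) \<in> p" for t K
      proof -
        obtain u v where "K = cbox u v" "t \<in> K" "K \<subseteq> {a..b}"
          using tagged_division_ofD[OF ptag] tK by metis
        moreover have "K \<subseteq> ball t (d t)" using fine tK by blast
        ultimately show ?thesis by (intro exI[of _ u] exI[of _ v]) auto
      qed
      have "(\<Sum>(t,K)\<in>p. measure lborel K *\<^sub>R g t) - (f b - f a) = sum D p"
        using additive_tagged_division_1[OF \<open>a \<le> b\<close> ptag, of f]
        by (simp add: D_def case_prod_unfold sum_subtractf)
      also have "\<dots> = sum D (p - pE) + sum D pE"
        using fin by (intro sum.subset_diff) (auto simp: pE_def)
      finally have split: "norm ((\<Sum>(t,K)\<in>p. measure lborel K *\<^sub>R g t) - (f b - f a))
          \<le> norm (sum D (p - pE)) + norm (sum D pE)"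
        by (simp add: norm_triangle_ineq)
      have "norm (sum D (p - pE)) \<le> (\<Sum>(t,K)\<in>p - pE. e1 * (Sup K - Inf K))"
      proof (rule sum_norm_le, clarify)
        fix t K assume tK: "(t,K) \<in> p" "(t,K) \<notin> pE"
        then have "t \<notin> E" by (auto simp: pE_def)
        obtain u v where uv: "u \<le> t" "t \<le> v" "a \<le> u" "v \<le> b" "Inf K = u" "Sup K = v"
          "measure lborel K = v - u" "{u..v} \<subseteq> ball t (d t)"
          using int[OF tK(1)] by metis
        \<comment> \<open>Straddle argument: the linearization of \<open>f\<close> at the tag is
          tested at both endpoints, and \<open>ru - rv\<close> is exactly
          \<open>D (t,K)\<close>.\<close>
        define ru rv where "ru = f u - f t - (u-t) *\<^sub>R f' t" and "rv = f v - f t - (v-t) *\<^sub>R f' t"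
        have "u \<in> ball t (d t)" "v \<in> ball t (d t)"
          using uv(1,2,8) by (simp_all add: subset_iff)
        then have r: "norm ru \<le> e1 * norm (u-t)" "norm rv \<le> e1 * norm (v-t)"
          unfolding ru_def rv_def
          using uv \<open>t \<notin> E\<close> dd[of t u] dd[of t v] by (auto simp: dist_real_def)
        have "norm (D (t,K)) = norm (ru - rv)"
          unfolding D_def g_def case_prod_conv uv(5-7) ru_def rv_def
          using \<open>t \<notin> E\<close> by (simp add: algebra_simps)
        then have "norm (D (t,K)) \<le> e1 * norm (u-t) + e1 * norm (v-t)"
          using r norm_triangle_ineq4[of ru rv] by linarith
        also have "\<dots> = e1 * (Sup K - Inf K)"
          using uv by (simp add: algebra_simps)
        finally show "norm (D (t,K)) \<le> e1 * (Sup K - Inf K)" .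
      qed
      also have "\<dots> \<le> (\<Sum>(t,K)\<in>p. e1 * (Sup K - Inf K))"
      proof (rule sum_mono2)
        show "0 \<le> (case z of (t,K) \<Rightarrow> e1 * (Sup K - Inf K))" if "z \<in> p - (p - pE)" for z
          using that e1(1) int[of "fst z" "snd z"] by (auto simp: case_prod_unfold)
      qed (use fin in auto)
      also have "\<dots> = e1 * (b - a)"
        using additive_tagged_division_1[OF \<open>a \<le> b\<close> ptag, of "\<lambda>x. x"]
        by (simp add: case_prod_unfold flip: sum_distrib_left)
      finally have b1: "norm (sum D (p - pE)) \<le> e / 2" using e1 by linarith
      \<comment> \<open>Forgetting the tags in \<open>E\<close> leaves a division contained in
        \<open>U\<close>, of total length below \<open>\<delta>\<close>, to which absolute
        continuity applies.\<close>
      define q where "q = snd ` pE"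
      have pE: "pE tagged_partial_division_of {a..b}"
      proof (rule tagged_partial_division_subset)
        show "p tagged_partial_division_of {a..b}" using ptag by (simp add: tagged_division_of_def)
      qed (auto simp: pE_def)
      have q: "q division_of \<Union>q"
        unfolding q_def using partial_division_of_tagged_division[OF pE] .
      have qfacts: "K \<subseteq> U \<and> K \<subseteq> {a..b} \<and> Sup K - Inf K = measure lebesgue K" if "K \<in> q" for K
      proof -
        obtain t where "(t,K) \<in> p" "t \<in> E" using \<open>K \<in> q\<close> by (auto simp: q_def pE_def)
        moreover from int[OF this(1)] obtain u v where "K = {u..v}" "a \<le> u" "v \<le> b"
          "Sup K - Inf K = measure lborel K" "K \<subseteq> ball t (d t)" by metis
        moreover from this(1-3) have "K \<subseteq> {a..b}" "measure lebesgue K = measure lborel K" by simp_all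
        ultimately show ?thesis using dE[of t] by auto
      qed
      have qU: "\<Union>q \<subseteq> U" and qS: "\<Union>q \<subseteq> {a..b}"
        using qfacts by auto
      have "(\<Sum>K\<in>q. Sup K - Inf K) = (\<Sum>K\<in>q. measure lebesgue K)"
        using qfacts by (intro sum.cong) auto
      also have "\<dots> = measure lebesgue (\<Union>q)"
        by (rule content_division[OF q])
      also have "\<dots> \<le> measure lebesgue U"
        using qU Um lmeasurable_division[OF q] by (intro measure_mono_fmeasurable) auto
      also have "\<dots> < \<delta>" by (rule Um2)
      finally have small: "(\<Sum>K\<in>q. norm (f (Sup K) - f (Inf K))) < e / 2"
        using \<delta> q qS by blast
      have "norm (sum D pE) \<le> (\<Sum>z\<in>pE. norm (f (Sup (snd z)) - f (Inf (snd z))))"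
        by (rule sum_norm_le) (auto simp: D_def g_def pE_def norm_minus_commute)
      also have "\<dots> = (\<Sum>K\<in>q. norm (f (Sup K) - f (Inf K)))"
        unfolding q_def
      proof (rule sum.reindex_nontrivial[symmetric, unfolded o_def])
        show "finite pE" using fin by (simp add: pE_def)
        \<comment> \<open>Two tags can share an interval only if it is degenerate; the increment of
          \<open>f\<close> over it is then zero, so passing from \<open>pE\<close> to
          \<open>q\<close> loses nothing.\<close>
        fix z w assume zw: "z \<in> pE" "w \<in> pE" "z \<noteq> w" "snd z = snd w"
        obtain t K s where z: "z = (t,K)" and w: "w = (s,K)" using zw(4) by (metis prod.collapse)
        have "interior K \<inter> interior K = {}"
          using tagged_partial_division_ofD(5)[OF pE, of t K s K] zw z w by auto
        moreover obtain u v where "K = {u..v}" "u \<le> v" "Inf K = u" "Sup K = v"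
          using int[of t K] zw z by (fastforce simp: pE_def)
        ultimately have "Sup K = Inf K" by (auto simp: box_eq_empty)
        then show "norm (f (Sup (snd z)) - f (Inf (snd z))) = 0" using z by simp
      qed
      finally show "norm ((\<Sum>(t,K)\<in>p. measure lborel K *\<^sub>R g t) - (f b - f a)) < e"
        using split b1 small by linarith
    qed
  qed
  moreover have "negligible E" using E by (simp add: negligible_iff_null_sets)
  ultimately show ?thesis
    by (rule has_integral_spike[rotated 2]) (auto simp: g_def)
qed

subsection \<open>Generalized Lyapunov operators\<close>

text \<open>With respect to the trace inner product this is the adjoint of the map sending
  \<open>X\<close> to \<open>A ** X + X ** transpose A + (\<Sum>i\<in>UNIV. N i ** X ** transpose (N
  i))\<close>. The Gramian equation uses it with the shifted matrix in place of
  \<open>A\<close>.\<close>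

definition gen_lyapunov ::
    "real ^ 'n ^ 'n \<Rightarrow> ('m::finite \<Rightarrow> real ^ 'n ^ 'n) \<Rightarrow> real ^ 'n ^ 'n \<Rightarrow> real ^ 'n ^ 'n"
  where "gen_lyapunov A N X =
    transpose A ** X + X ** A + (\<Sum>i\<in>UNIV. transpose (N i) ** X ** N i)"

section \<open>Matrix identities, linearity and the quadratic form of the operator\<close>

lemma transpose_add: "transpose (X + Y) = transpose X + transpose (Y :: 'a::plus ^ 'n ^ 'm)"
  by (simp add: vec_eq_iff transpose_def)

lemma transpose_diff: "transpose (X - Y) = transpose X - transpose (Y :: 'a::minus ^ 'n ^ 'm)"
  by (simp add: vec_eq_iff transpose_def)

lemma transpose_sum: "transpose (sum f I) = (\<Sum>i\<in>I. transpose (f i :: 'a::comm_monoid_add ^ 'n ^ 'm))"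
  by (simp add: vec_eq_iff transpose_def)

lemma transpose_scaleR: "transpose (c *\<^sub>R X) = c *\<^sub>R transpose (X :: 'a::real_vector ^ 'n ^ 'm)"
  by (simp add: vec_eq_iff transpose_def)

lemma matrix_add_rdistrib:
  fixes A B :: "'a::semiring_1 ^ 'n ^ 'm"
  shows "(A + B) ** C = A ** C + B ** C"
  by (simp add: vec_eq_iff matrix_matrix_mult_def sum.distrib distrib_right)

lemma sum_matrix_vector_mult:
  fixes f :: "'i \<Rightarrow> 'a::ring_1 ^ 'n ^ 'm"
  shows "sum f I *v v = (\<Sum>i\<in>I. f i *v v)"
  by (induction I rule: infinite_finite_induct) (auto simp: matrix_vector_mult_add_rdistrib)

lemma vector_matrix_mult_sum:
  fixes f :: "'i \<Rightarrow> 'a::ring_1 ^ 'n ^ 'm"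
  shows "v v* sum f I = (\<Sum>i\<in>I. v v* f i)"
  by (induction I rule: infinite_finite_induct) (auto simp: vector_matrix_mult_add_rdistrib)

lemma linear_gen_lyapunov:
  fixes A :: "real ^ 'n ^ 'n"
  shows "linear (gen_lyapunov A N)"
proof
  fix X Y :: "real ^ 'n ^ 'n" and c :: real
  show "gen_lyapunov A N (X + Y) = gen_lyapunov A N X + gen_lyapunov A N Y"
    by (simp add: gen_lyapunov_def matrix_add_ldistrib matrix_add_rdistrib sum.distrib)
  show "gen_lyapunov A N (c *\<^sub>R X) = c *\<^sub>R gen_lyapunov A N X"
    by (simp add: gen_lyapunov_def matrix_scalar_ac scalar_matrix_assoc scaleR_sum_right
        scaleR_add_right)
qed

lemma gen_lyapunov_transpose:
  "gen_lyapunov A N (transpose X) = transpose (gen_lyapunov A N X)"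
  by (simp add: gen_lyapunov_def transpose_add transpose_sum matrix_transpose_mul
      transpose_transpose matrix_mul_assoc add.commute)

lemma inner_transpose_mult:
  fixes A :: "real ^ 'n ^ 'm"
  shows "v \<bullet> (transpose A *v w) = (A *v v) \<bullet> w"
  by (metis dot_lmul_matrix inner_commute transpose_matrix_vector)

text \<open>Each transpose moves across the inner product onto \<open>v\<close>. In this form the
  terms in \<open>A\<close> vanish at a kernel vector of a symmetric \<open>X\<close>, and the terms
  in \<open>N i\<close> are nonnegative once \<open>X\<close> is positive semidefinite.\<close>

lemma gen_lyapunov_form:
  "v \<bullet> (gen_lyapunov A N X *v v) =
     (A *v v) \<bullet> (X *v v) + v \<bullet> (X *v (A *v v)) + (\<Sum>i\<in>UNIV. (N i *v v) \<bullet> (X *v (N i *v v)))"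
  by (simp add: gen_lyapunov_def matrix_vector_mult_add_rdistrib sum_matrix_vector_mult inner_add_right
      inner_sum_right inner_transpose_mult matrix_vector_mul_assoc[symmetric] del: transpose_matrix_vector)

section \<open>Link between the operator and the spectrum of the Kronecker matrix\<close>

text \<open>The vectorization identity, with the entries of \<open>X\<close> indexed by pairs.
  Letting the Kronecker product act on a row vector produces the transpose on the left factor, as
  the Gramian equation requires.\<close>

lemma vec_vector_kronecker:
  fixes A B X :: "real ^ 'n ^ 'n"
  shows "(\<chi> p. X $ fst p $ snd p) v* (A \<otimes>\<^sub>K B)
       = (\<chi> p. (transpose A ** X ** B) $ fst p $ snd p)"
proof -
  have "(\<Sum>q\<in>UNIV. X $ fst q $ snd q * (A $ fst q $ i * B $ snd q $ j))
      = (\<Sum>k\<in>UNIV. (\<Sum>l\<in>UNIV. A $ l $ i * X $ l $ k) * B $ k $ j)" for i j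
  proof -
    have "(\<Sum>q\<in>UNIV. X $ fst q $ snd q * (A $ fst q $ i * B $ snd q $ j))
        = (\<Sum>l\<in>UNIV. \<Sum>k\<in>UNIV. X $ l $ k * (A $ l $ i * B $ k $ j))"
      by (simp add: sum.cartesian_product case_prod_unfold)
    also have "\<dots> = (\<Sum>k\<in>UNIV. \<Sum>l\<in>UNIV. X $ l $ k * (A $ l $ i * B $ k $ j))"
      by (rule sum.swap)
    finally show ?thesis by (simp add: sum_distrib_right sum_distrib_left mult_ac)
  qed
  then show ?thesis
    by (simp add: vec_eq_iff vector_matrix_mult_def kronecker_def matrix_matrix_mult_def transpose_def)
qed

lemma vec_vector_kronecker_sum:
  "(\<chi> p. X $ fst p $ snd p) v* (mat 1 \<otimes>\<^sub>K A + A \<otimes>\<^sub>K mat 1 + (\<Sum>i\<in>UNIV. N i \<otimes>\<^sub>K N i))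
   = (\<chi> p. gen_lyapunov A N X $ fst p $ snd p)"
  by (simp add: vector_matrix_mult_add_rdistrib vector_matrix_mult_sum vec_vector_kronecker
      gen_lyapunov_def transpose_mat vec_eq_iff)

lemma vector_matrix_mult_scaleR_mat_1: "v v* (s *\<^sub>R mat 1) = s *\<^sub>R (v :: real ^ 'n)"
  by (simp add: vec_eq_iff vector_matrix_mult_def mat_def if_distrib cong: if_cong)

text \<open>Vectorizing \<open>X\<close> gives a real left eigenvector of the Kronecker matrix. A
  square matrix has the same left and right eigenvalues, and a real right eigenvector is also a
  complex one.\<close>

lemma gen_lyapunov_eigenvalue:
  assumes "gen_lyapunov A N X = s *\<^sub>R X" and "X \<noteq> 0"
  shows "complex_of_real s
    \<in> spectrum (mat 1 \<otimes>\<^sub>K A + A \<otimes>\<^sub>K mat 1 + (\<Sum>i\<in>UNIV. N i \<otimes>\<^sub>K N i))" (is "_ \<in> spectrum ?K")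
proof -
  define w where "w = (\<chi> p. X $ fst p $ snd p)"
  have "w v* ?K = s *\<^sub>R w"
    using assms(1) by (simp add: w_def vec_vector_kronecker_sum vec_eq_iff)
  define Z where "Z = ?K - s *\<^sub>R mat 1"
  from \<open>w v* ?K = s *\<^sub>R w\<close> have "w v* Z = 0"
    by (simp only: Z_def vector_matrix_mult_diff_rdistrib vector_matrix_mult_scaleR_mat_1) simp
  moreover have "w \<noteq> 0"
    using assms(2) by (auto simp: w_def vec_eq_iff)
  \<comment> \<open>The passage from left to right kernel: \<open>w\<close> rules out a left inverse
    of \<open>transpose Z\<close>, hence a right inverse of \<open>Z\<close>, hence a left inverse
    of \<open>Z\<close>.\<close>
  ultimately have "\<nexists>B. B ** transpose Z = mat 1"
    unfolding matrix_left_invertible_ker by auto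
  then have "\<nexists>B. B ** Z = mat 1"
    unfolding left_invertible_transpose using matrix_left_right_inverse[of _ Z] by blast
  then obtain v where v: "Z *v v = 0" "v \<noteq> 0"
    unfolding matrix_left_invertible_ker by blast
  then have "?K *v v = s *\<^sub>R v"
    unfolding Z_def matrix_vector_mult_diff_rdistrib scaleR_matrix_vector_assoc[symmetric] by simp
  then have "complex_of_real ((?K *v v) $ p) = complex_of_real s * complex_of_real (v $ p)" for p
    by simp
  then have "map_matrix complex_of_real ?K *v (\<chi> p. complex_of_real (v $ p))
      = complex_of_real s *s (\<chi> p. complex_of_real (v $ p))"
    by (simp add: vec_eq_iff matrix_vector_mult_def del: vector_add_component)
  moreover have "(\<chi> p. complex_of_real (v $ p)) \<noteq> 0"
    using v(2) by (simp add: vec_eq_iff)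
  ultimately show ?thesis unfolding spectrum_def by blast
qed

section \<open>Continuation in the parameter and positivity of solutions\<close>

text \<open>In finite dimension injectivity gives a solution for every parameter. A lower bound on
  the operators that is uniform in \<open>\<theta>\<close> makes these solutions bounded and
  Lipschitz in \<open>\<theta>\<close>.\<close>

lemma homotopy_solution:
  fixes F :: "'a::euclidean_space \<Rightarrow> 'a"
  assumes F: "linear F"
    and inj: "\<And>\<theta> x. \<lbrakk>\<theta> \<in> {0..1}; (1 - \<theta>) *\<^sub>R x - \<theta> *\<^sub>R F x = 0\<rbrakk> \<Longrightarrow> x = 0"
  obtains X where "continuous_on {0..1::real} X"
    "\<And>\<theta>. \<theta> \<in> {0..1} \<Longrightarrow> (1 - \<theta>) *\<^sub>R X \<theta> - \<theta> *\<^sub>R F (X \<theta>) = P"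
proof -
  define M where "M \<theta> x = (1 - \<theta>) *\<^sub>R x - \<theta> *\<^sub>R F x" for \<theta> x
  have lin: "linear (M \<theta>)" for \<theta>
    unfolding M_def
    by (intro linear_compose_sub linear_compose_scale_right F linear_ident)
  have "surj (M \<theta>)" if "\<theta> \<in> {0..1}" for \<theta>
    using lin inj[OF that] linear_injective_imp_surjective
    by (metis M_def linear_injective_0)
  then have "\<forall>\<theta>\<in>{0..1}. \<exists>x. M \<theta> x = P" by (metis surjD)
  then obtain X where X: "\<And>\<theta>. \<theta> \<in> {0..1} \<Longrightarrow> M \<theta> (X \<theta>) = P" by metis
  have Fcont: "continuous_on S F" for S
    using F by (simp add: linear_continuous_on linear_linear)
  \<comment> \<open>On this compact set \<open>norm (M \<theta> x)\<close> attains its minimum,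
    which is positive by injectivity; it becomes the uniform lower bound \<open>c\<close>.\<close>
  let ?D = "{0..1::real} \<times> sphere (0::'a) 1"
  have "continuous_on ?D (\<lambda>z. norm (M (fst z) (snd z)))"
    unfolding M_def
    by (intro continuous_intros continuous_on_compose2[OF Fcont[of UNIV]]) auto
  moreover have "compact ?D" by (intro compact_Times compact_Icc compact_sphere)
  moreover have "?D \<noteq> {}" by auto
  ultimately have "\<exists>z\<in>?D. \<forall>w\<in>?D. norm (M (fst z) (snd z)) \<le> norm (M (fst w) (snd w))"
    by (intro continuous_attains_inf)
  then obtain z where z: "z \<in> ?D"
    and zmin: "\<And>w. w \<in> ?D \<Longrightarrow> norm (M (fst z) (snd z)) \<le> norm (M (fst w) (snd w))"
    by blast
  define c where "c = norm (M (fst z) (snd z))"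
  have "c > 0"
    using z inj[of "fst z" "snd z"] by (auto simp: c_def M_def)
  have low: "c * norm x \<le> norm (M \<theta> x)" if "\<theta> \<in> {0..1}" for \<theta> x
  proof (cases "x = 0")
    case False
    have "c \<le> norm (M \<theta> (x /\<^sub>R norm x))"
      using zmin[of "(\<theta>, x /\<^sub>R norm x)"] that False by (simp add: c_def)
    also have "\<dots> = norm (M \<theta> x) / norm x"
      using lin by (simp add: linear_cmul divide_inverse_commute)
    finally show ?thesis using False by (simp add: field_simps)
  qed simp
  obtain b where "b > 0" and b: "\<And>x. norm (F x) \<le> b * norm x"
    using F linear_bounded_pos by blast
  have bound: "norm (X \<theta>) \<le> norm P / c" if "\<theta> \<in> {0..1}" for \<theta>
    using low[OF that, of "X \<theta>"] X[OF that] \<open>c > 0\<close> by (simp add: field_simps)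
  have "norm (X \<theta> - X \<tau>) \<le> (1 + b) * norm P / c\<^sup>2 * \<bar>\<theta> - \<tau>\<bar>"
    if \<theta>: "\<theta> \<in> {0..1}" and \<tau>: "\<tau> \<in> {0..1}" for \<theta> \<tau>
  proof -
    \<comment> \<open>A resolvent identity: replacing \<open>P\<close> by
      \<open>M \<tau> (X \<tau>)\<close> exposes the factor
      \<open>\<theta> - \<tau>\<close>.\<close>
    have "M \<theta> (X \<theta> - X \<tau>) = P - M \<theta> (X \<tau>)"
      using X[OF \<theta>] lin by (simp add: linear_diff)
    also have "\<dots> = (\<theta> - \<tau>) *\<^sub>R (X \<tau> + F (X \<tau>))"
      by (subst X[OF \<tau>, symmetric]) (simp add: M_def algebra_simps)
    finally have "norm (M \<theta> (X \<theta> - X \<tau>)) = \<bar>\<theta> - \<tau>\<bar> * norm (X \<tau> + F (X \<tau>))"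
      by simp
    also have "\<dots> \<le> \<bar>\<theta> - \<tau>\<bar> * ((1 + b) * (norm P / c))"
    proof (intro mult_left_mono)
      have "norm (X \<tau> + F (X \<tau>)) \<le> (1 + b) * norm (X \<tau>)"
        using norm_triangle_ineq[of "X \<tau>" "F (X \<tau>)"] b[of "X \<tau>"] by (simp add: algebra_simps)
      also have "\<dots> \<le> (1 + b) * (norm P / c)"
        using bound[OF \<tau>] \<open>b > 0\<close> by (intro mult_left_mono) auto
      finally show "norm (X \<tau> + F (X \<tau>)) \<le> (1 + b) * (norm P / c)" .
    qed simp
    finally have "c * norm (X \<theta> - X \<tau>) \<le> \<bar>\<theta> - \<tau>\<bar> * ((1 + b) * (norm P / c))"
      using low[OF \<theta>, of "X \<theta> - X \<tau>"] by linarith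
    then show ?thesis using \<open>c > 0\<close> by (simp add: field_simps power2_eq_square)
  qed
  then have "((1 + b) * norm P / c\<^sup>2)-lipschitz_on {0..1} X"
    using \<open>b > 0\<close> by (intro lipschitz_onI) (auto simp: dist_norm)
  then have "continuous_on {0..1} X"
    by (rule lipschitz_on_continuous_on)
  then show ?thesis using that X unfolding M_def by blast
qed

text \<open>Moving from \<open>v\<close> in the direction \<open>- X *v v\<close> lowers the form to
  first order, which positivity forbids unless \<open>X *v v = 0\<close>.\<close>

lemma psd_form_zero:
  fixes X :: "real ^ 'n ^ 'n"
  assumes sym: "transpose X = X" and psd: "\<And>w. 0 \<le> w \<bullet> (X *v w)" and zero: "v \<bullet> (X *v v) = 0"
  shows "X *v v = 0"
proof -
  define w where "w = X *v v"
  define b where "b = w \<bullet> (X *v w)"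
  \<comment> \<open>This step length makes the form at \<open>v - t *\<^sub>R w\<close> equal to
    \<open>- t\<^sup>2 * (b + 2)\<close>; the summand 1 avoids division by zero when
    \<open>b = 0\<close>.\<close>
  define t where "t = (w \<bullet> w) / (b + 1)"
  have "b \<ge> 0" using psd by (simp add: b_def)
  then have ww: "w \<bullet> w = t * (b + 1)" by (simp add: t_def)
  have vw: "v \<bullet> (X *v w) = w \<bullet> w"
    using inner_transpose_mult[of v X w] sym by (simp add: w_def)
  have "0 \<le> (v - t *\<^sub>R w) \<bullet> (X *v (v - t *\<^sub>R w))" by (rule psd)
  also have "\<dots> = t\<^sup>2 * b - 2 * t * (w \<bullet> w)"
    using zero vw
    by (simp add: b_def matrix_vector_mult_diff_distrib matrix_vector_mult_scaleR inner_diff_left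
        inner_diff_right power2_eq_square flip: w_def) (simp add: algebra_simps)
  also have "\<dots> = t\<^sup>2 * b - 2 * t\<^sup>2 * (b + 1)"
    by (simp add: ww power2_eq_square)
  finally have "t\<^sup>2 * (b + 2) \<le> 0" by (simp add: algebra_simps)
  then have "t\<^sup>2 \<le> 0" using \<open>b \<ge> 0\<close> by (simp add: mult_le_0_iff)
  then have "t = 0" by simp
  then show ?thesis using \<open>b \<ge> 0\<close> by (simp add: t_def w_def)
qed

text \<open>Join \<open>P\<close> to \<open>X1\<close> by the solutions \<open>X \<theta>\<close> of \<open>(1 - \<theta>) X - \<theta> L X = P\<close>. At the first \<open>\<theta>\<close> where
  \<open>X \<theta>\<close> stops being positive definite it has a kernel vector \<open>v\<close>, and there the form of the left-hand
  side is \<open>- \<theta> \<Sum>\<^sub>i (N\<^sub>i v)\<^sup>T X (N\<^sub>i v) \<le> 0\<close>.\<close>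

lemma gen_lyapunov_positive:
  fixes A P X1 :: "real ^ 'n ^ 'n"
  assumes inj: "\<And>s X. \<lbrakk>s \<ge> 0; gen_lyapunov A N X = s *\<^sub>R X\<rbrakk> \<Longrightarrow> X = 0"
    and P_sym: "transpose P = P" and P_pos: "\<And>v. v \<noteq> 0 \<Longrightarrow> 0 < v \<bullet> (P *v v)"
    and X1: "gen_lyapunov A N X1 = - P"
  shows "0 \<le> v \<bullet> (X1 *v v)"
proof -
  note L = linear_gen_lyapunov[of A N]
  \<comment> \<open>For \<open>\<theta> > 0\<close>, division by \<open>\<theta>\<close> gives the
    eigenvalue equation with \<open>s = (1 - \<theta>) / \<theta> \<ge> 0\<close>; for
    \<open>\<theta> = 0\<close> the operator is the identity.\<close>
  have inj': "Y = 0" if "\<theta> \<in> {0..1}" "(1 - \<theta>) *\<^sub>R Y - \<theta> *\<^sub>R gen_lyapunov A N Y = 0" for \<theta> Y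
  proof (cases "\<theta> = 0")
    case False
    have e: "\<theta> *\<^sub>R gen_lyapunov A N Y = (1 - \<theta>) *\<^sub>R Y"
      using that(2) by simp
    have "gen_lyapunov A N Y = (1 / \<theta>) *\<^sub>R (\<theta> *\<^sub>R gen_lyapunov A N Y)"
      using False by simp
    also have "\<dots> = ((1 - \<theta>) / \<theta>) *\<^sub>R Y"
      unfolding e by simp
    finally show ?thesis using that(1) by (intro inj[of "(1 - \<theta>) / \<theta>"]) simp_all
  qed (use that in simp)
  obtain X where cont: "continuous_on {0..1} X"
    and X: "\<And>\<theta>. \<theta> \<in> {0..1} \<Longrightarrow> (1 - \<theta>) *\<^sub>R X \<theta> - \<theta> *\<^sub>R gen_lyapunov A N (X \<theta>) = P"
  proof (rule homotopy_solution[OF L, where P = P])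
    show "Y = 0" if "\<theta> \<in> {0..1}" "(1 - \<theta>) *\<^sub>R Y - \<theta> *\<^sub>R gen_lyapunov A N Y = 0" for \<theta> Y
      by (rule inj'[OF that])
  qed (rule that, assumption+)
  have uniq: "Y = X \<theta>" if "\<theta> \<in> {0..1}" "(1 - \<theta>) *\<^sub>R Y - \<theta> *\<^sub>R gen_lyapunov A N Y = P" for \<theta> Y
  proof -
    have "(1 - \<theta>) *\<^sub>R (Y - X \<theta>) - \<theta> *\<^sub>R gen_lyapunov A N (Y - X \<theta>)
        = ((1 - \<theta>) *\<^sub>R Y - \<theta> *\<^sub>R gen_lyapunov A N Y)
          - ((1 - \<theta>) *\<^sub>R X \<theta> - \<theta> *\<^sub>R gen_lyapunov A N (X \<theta>))"
      by (simp add: linear_diff[OF L] algebra_simps)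
    also have "\<dots> = 0" using that(2) X[OF that(1)] by simp
    finally have "(1 - \<theta>) *\<^sub>R (Y - X \<theta>) - \<theta> *\<^sub>R gen_lyapunov A N (Y - X \<theta>) = 0" .
    from inj'[OF that(1) this] show ?thesis by simp
  qed
  \<comment> \<open>The transpose solves the same equation, since \<open>P\<close> is symmetric, so
    uniqueness applies.\<close>
  have sym: "transpose (X \<theta>) = X \<theta>" if "\<theta> \<in> {0..1}" for \<theta>
  proof (rule uniq[OF that])
    show "(1 - \<theta>) *\<^sub>R transpose (X \<theta>) - \<theta> *\<^sub>R gen_lyapunov A N (transpose (X \<theta>)) = P"
      using arg_cong[OF X[OF that], of transpose] P_sym
      by (simp add: gen_lyapunov_transpose transpose_diff transpose_scaleR)
  qed
  define q where "q z = snd z \<bullet> (X (fst z) *v snd z)" for z :: "real \<times> (real ^ 'n)"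
  have q_cont: "continuous_on ({0..1} \<times> UNIV) q"
    unfolding q_def inner_vec_def matrix_vector_mult_def
    by (simp, intro continuous_intros continuous_on_compose2[OF cont]) auto
  \<comment> \<open>Pairs of a parameter and a unit vector at which strict positivity fails.
    Compactness supplies a least such parameter if there is any.\<close>
  define S where "S = {z \<in> {0..1} \<times> sphere 0 1. q z \<le> 0}"
  have "closed (({0..1} \<times> sphere 0 1) \<inter> q -` {..0})"
    by (intro continuous_closed_preimage continuous_on_subset[OF q_cont] closed_Times closed_sphere) auto
  also have "({0..1} \<times> sphere 0 1) \<inter> q -` {..0} = S"
    by (auto simp: S_def)
  finally have "closed S" .
  have "S = {}"
  proof (rule ccontr)
    assume "S \<noteq> {}"
    have "bounded S"
      by (rule bounded_subset[of "{0..1} \<times> sphere 0 1"]) (auto simp: S_def intro: bounded_Times)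
    then have "compact (fst ` S)"
      using \<open>closed S\<close> by (intro compact_continuous_image continuous_intros) (simp add: compact_eq_bounded_closed)
    then obtain \<theta> where "\<theta> \<in> fst ` S" and min: "\<And>\<tau>. \<tau> \<in> fst ` S \<Longrightarrow> \<theta> \<le> \<tau>"
      using compact_attains_inf[of "fst ` S"] \<open>S \<noteq> {}\<close> by auto
    then obtain v where \<theta>: "\<theta> \<in> {0..1}" and v: "norm v = 1" "q (\<theta>, v) \<le> 0"
      by (auto simp: S_def)
    have "X 0 = P" using X[of 0] by simp
    moreover have "v \<noteq> 0" using v(1) by auto
    ultimately have "\<theta> \<noteq> 0"
      using v P_pos[of v] by (auto simp: q_def)
    \<comment> \<open>A negative value at \<open>\<theta>\<close> would persist at a slightly
      smaller parameter by continuity, against minimality; \<open>\<theta> \<noteq> 0\<close> leaves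
      room for such a parameter.\<close>
    have nonneg_sphere: "0 \<le> q (\<theta>, w)" if w: "norm w = 1" for w
    proof (rule ccontr)
      assume neg: "\<not> 0 \<le> q (\<theta>, w)"
      have "continuous_on {0..1} (\<lambda>\<tau>. q (\<tau>, w))"
        by (rule continuous_on_compose2[OF q_cont]) (auto intro: continuous_intros)
      then obtain \<delta> where "\<delta> > 0" and \<delta>: "\<And>\<tau>. \<lbrakk>\<tau> \<in> {0..1}; dist \<tau> \<theta> < \<delta>\<rbrakk>
          \<Longrightarrow> dist (q (\<tau>, w)) (q (\<theta>, w)) < - q (\<theta>, w)"
        unfolding continuous_on_iff using \<theta> neg by (meson neg_0_less_iff_less not_le)
      define \<tau> where "\<tau> = max 0 (\<theta> - \<delta> / 2)"
      have \<tau>: "\<tau> \<in> {0..1}" "dist \<tau> \<theta> < \<delta>" "\<tau> < \<theta>"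
        using \<theta> \<open>\<theta> \<noteq> 0\<close> \<open>\<delta> > 0\<close> by (auto simp: \<tau>_def dist_real_def)
      have "q (\<tau>, w) \<le> 0" using \<delta>[OF \<tau>(1,2)] by (simp add: dist_real_def)
      then have "\<tau> \<in> fst ` S" using \<tau> w by (force simp: S_def)
      then show False using min \<tau>(3) by fastforce
    qed
    have nonneg: "0 \<le> w \<bullet> (X \<theta> *v w)" for w
    proof (cases "w = 0")
      case False
      then have "0 \<le> q (\<theta>, w /\<^sub>R norm w)" by (intro nonneg_sphere) simp
      then show ?thesis
        using False by (simp add: q_def matrix_vector_mult_scaleR zero_le_mult_iff)
    qed simp
    have kernel: "X \<theta> *v v = 0"
      using psd_form_zero[OF sym[OF \<theta>] nonneg] nonneg[of v] v(2) by (simp add: q_def)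
    have "v \<bullet> (X \<theta> *v w) = 0" for w
      using inner_transpose_mult[of v "X \<theta>" w] kernel by (simp add: sym[OF \<theta>])
    then have "v \<bullet> (gen_lyapunov A N (X \<theta>) *v v) = (\<Sum>i\<in>UNIV. (N i *v v) \<bullet> (X \<theta> *v (N i *v v)))"
      using kernel by (simp add: gen_lyapunov_form)
    then have "0 \<le> v \<bullet> (gen_lyapunov A N (X \<theta>) *v v)"
      using nonneg by (simp add: sum_nonneg)
    moreover have "v \<bullet> (P *v v) = - \<theta> * (v \<bullet> (gen_lyapunov A N (X \<theta>) *v v))"
      using kernel by (subst X[OF \<theta>, symmetric])
        (simp add: matrix_vector_mult_diff_rdistrib flip: scaleR_matrix_vector_assoc)
    ultimately have "v \<bullet> (P *v v) \<le> 0" using \<theta> by simp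
    then show False using P_pos[of v] v(1) by fastforce
  qed
  have "X1 = X 1" using uniq[of 1 X1] X1 by simp
  show ?thesis
  proof (cases "v = 0")
    case False
    then have "q (1, v /\<^sub>R norm v) > 0"
      using \<open>S = {}\<close> by (auto simp: S_def not_le)
    then show ?thesis
      using False \<open>X1 = X 1\<close> by (simp add: q_def matrix_vector_mult_scaleR zero_less_mult_iff)
  qed simp
qed

text \<open>Symmetry follows from injectivity, applied to \<open>transpose Q - Q\<close>. As
  \<open>P\<close> is only semidefinite, it is perturbed to \<open>P + e *\<^sub>R mat 1\<close>,
  whose solution is \<open>Q + e *\<^sub>R E\<close>; the limit as \<open>e\<close> decreases to 0
  gives the bound for \<open>Q\<close>.\<close>

lemma gen_lyapunov_solution_psd:
  fixes A P Q :: "real ^ 'n ^ 'n"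
  assumes inj: "\<And>s X. \<lbrakk>s \<ge> 0; gen_lyapunov A N X = s *\<^sub>R X\<rbrakk> \<Longrightarrow> X = 0"
    and P_sym: "transpose P = P" and P_psd: "\<And>v. 0 \<le> v \<bullet> (P *v v)"
    and Q: "gen_lyapunov A N Q = - P"
  shows "transpose Q = Q" and "0 \<le> v \<bullet> (Q *v v)"
proof -
  note L = linear_gen_lyapunov[of A N]
  have "transpose (- P) = - P"
    using P_sym transpose_scaleR[of "-1" P] by simp
  then have "gen_lyapunov A N (transpose Q - Q) = 0 *\<^sub>R (transpose Q - Q)"
    by (simp add: linear_diff[OF L] gen_lyapunov_transpose Q)
  from inj[OF _ this] show "transpose Q = Q" by simp
  have "inj (gen_lyapunov A N)"
    using inj[of 0] by (simp add: linear_injective_0[OF L])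
  then obtain E where E: "gen_lyapunov A N E = - mat 1"
    using linear_injective_imp_surjective[OF L] by (metis surjD)
  have pert: "0 \<le> v \<bullet> (Q *v v) + e * (v \<bullet> (E *v v))" if "e > 0" for e
  proof -
    have "0 \<le> v \<bullet> ((Q + e *\<^sub>R E) *v v)"
    proof (rule gen_lyapunov_positive)
      show "X = 0" if "0 \<le> s" "gen_lyapunov A N X = s *\<^sub>R X" for s X
        by (rule inj[OF that])
      show "transpose (P + e *\<^sub>R mat 1) = P + e *\<^sub>R mat 1"
        by (simp add: transpose_add transpose_scaleR P_sym transpose_mat)
      show "0 < v \<bullet> ((P + e *\<^sub>R mat 1) *v v)" if "v \<noteq> 0" for v
        using that \<open>e > 0\<close> P_psd[of v]
        by (simp add: matrix_vector_mult_add_rdistrib inner_add_right add_nonneg_pos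
            flip: scaleR_matrix_vector_assoc)
      show "gen_lyapunov A N (Q + e *\<^sub>R E) = - (P + e *\<^sub>R mat 1)"
        by (simp add: linear_add[OF L] linear_cmul[OF L] Q E)
    qed
    then show ?thesis
      by (simp add: matrix_vector_mult_add_rdistrib inner_add_right flip: scaleR_matrix_vector_assoc)
  qed
  have "((\<lambda>e. v \<bullet> (Q *v v) + e * (v \<bullet> (E *v v))) \<longlongrightarrow> v \<bullet> (Q *v v) + 0 * (v \<bullet> (E *v v))) (at_right 0)"
    by (intro tendsto_intros)
  then show "0 \<le> v \<bullet> (Q *v v)"
    using pert by (intro tendsto_lowerbound[of _ _ "at_right 0"])
      (auto simp: eventually_at_right_less intro: eventually_mono[OF eventually_at_right_less])
qed

subsection \<open>The energy estimate\<close>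

text \<open>A pointwise estimate, with \<open>v\<close> a state and \<open>w\<close> a control
  value. Pairing the Gramian equation with \<open>v\<close> turns the shift into
  \<open>k\<^sup>2 * (v \<bullet> (Q *v v))\<close>, which pays for the squares arising from the
  bilinear terms.\<close>

lemma dissipation_inequality:
  fixes A Q :: "real ^ 'n ^ 'n" and B :: "real ^ 'm ^ 'n" and C :: "real ^ 'n ^ 'p"
  assumes sym: "transpose Q = Q" and psd: "\<And>v. 0 \<le> v \<bullet> (Q *v v)"
    and gramian: "gen_lyapunov (A + (k\<^sup>2 / 2) *\<^sub>R mat 1) N Q = - (transpose C ** C)"
    and w: "norm w \<le> k"
  shows "2 * (v \<bullet> (Q *v (A *v v + B *v w + (\<Sum>i\<in>UNIV. (w $ i) *\<^sub>R (N i *v v)))))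
      \<le> 2 * (v \<bullet> (Q *v (B *v w))) - (norm (C *v v))\<^sup>2"
proof -
  define n where "n i = N i *v v" for i
  have swap: "a \<bullet> (Q *v b) = b \<bullet> (Q *v a)" for a b
    using inner_transpose_mult[of a Q b] by (simp only: sym inner_commute)
  have "v \<bullet> (- (transpose C ** C) *v v) = - (norm (C *v v))\<^sup>2"
    by (simp add: inner_transpose_mult power2_norm_eq_inner matrix_vector_mul_assoc[symmetric]
        scaleR_matrix_vector_assoc[of "-1", simplified, symmetric] del: transpose_matrix_vector)
  moreover have "v \<bullet> (gen_lyapunov (A + (k\<^sup>2 / 2) *\<^sub>R mat 1) N Q *v v)
      = 2 * (v \<bullet> (Q *v (A *v v))) + k\<^sup>2 * (v \<bullet> (Q *v v)) + (\<Sum>i\<in>UNIV. n i \<bullet> (Q *v n i))"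
    using swap[of "A *v v" v]
    by (simp add: gen_lyapunov_form n_def matrix_vector_mult_add_rdistrib matrix_vector_right_distrib
        inner_add_left inner_add_right matrix_vector_mult_scaleR flip: scaleR_matrix_vector_assoc)
  ultimately have gram: "2 * (v \<bullet> (Q *v (A *v v))) + k\<^sup>2 * (v \<bullet> (Q *v v)) + (\<Sum>i\<in>UNIV. n i \<bullet> (Q *v n i))
      = - (norm (C *v v))\<^sup>2"
    using gramian by simp
  \<comment> \<open>Expansion of the nonnegative form of \<open>Q\<close> at
    \<open>w $ i *\<^sub>R v - n i\<close>.\<close>
  have young: "2 * (w $ i * (v \<bullet> (Q *v n i))) \<le> (w $ i)\<^sup>2 * (v \<bullet> (Q *v v)) + n i \<bullet> (Q *v n i)" for i
  proof -
    have "0 \<le> (w $ i *\<^sub>R v - n i) \<bullet> (Q *v (w $ i *\<^sub>R v - n i))" by (rule psd)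
    also have "\<dots> = (w $ i)\<^sup>2 * (v \<bullet> (Q *v v)) + n i \<bullet> (Q *v n i) - 2 * (w $ i * (v \<bullet> (Q *v n i)))"
      using swap[of "n i" v]
      by (simp add: matrix_vector_mult_diff_distrib matrix_vector_mult_scaleR inner_diff_left
          inner_diff_right power2_eq_square) (simp add: algebra_simps)
    finally show ?thesis by simp
  qed
  have norm_w: "(norm w)\<^sup>2 = (\<Sum>i\<in>UNIV. (w $ i)\<^sup>2)"
    unfolding power2_norm_eq_inner by (simp add: inner_vec_def power2_eq_square)
  have "2 * (\<Sum>i\<in>UNIV. w $ i * (v \<bullet> (Q *v n i)))
      \<le> (\<Sum>i\<in>UNIV. (w $ i)\<^sup>2 * (v \<bullet> (Q *v v)) + n i \<bullet> (Q *v n i))"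
    unfolding sum_distrib_left by (intro sum_mono young)
  also have "\<dots> = (norm w)\<^sup>2 * (v \<bullet> (Q *v v)) + (\<Sum>i\<in>UNIV. n i \<bullet> (Q *v n i))"
    by (simp add: sum.distrib norm_w sum_distrib_right)
  also have "\<dots> \<le> k\<^sup>2 * (v \<bullet> (Q *v v)) + (\<Sum>i\<in>UNIV. n i \<bullet> (Q *v n i))"
    using w psd by (intro add_right_mono mult_right_mono power_mono) auto
  finally have "2 * (\<Sum>i\<in>UNIV. w $ i * (v \<bullet> (Q *v n i)))
      \<le> k\<^sup>2 * (v \<bullet> (Q *v v)) + (\<Sum>i\<in>UNIV. n i \<bullet> (Q *v n i))" .
  moreover have "v \<bullet> (Q *v (\<Sum>i\<in>UNIV. (w $ i) *\<^sub>R n i)) = (\<Sum>i\<in>UNIV. w $ i * (v \<bullet> (Q *v n i)))"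
    by (simp add: linear_sum[OF matrix_vector_mul_linear] matrix_vector_mult_scaleR inner_sum_right)
  ultimately show ?thesis
    using gram by (simp add: matrix_vector_right_distrib inner_add_right flip: n_def)
qed

section \<open>Regularity of the quadratic form and of the input term\<close>

text \<open>The path stays in a ball of some radius \<open>M\<close>, on which the form is Lipschitz
  with constant \<open>2 * M * c\<close>, where \<open>c\<close> bounds the operator norm of
  \<open>Q\<close>.\<close>

lemma abs_cont_on_quadratic_form:
  fixes x :: "real \<Rightarrow> real ^ 'n"
  assumes x: "abs_cont_on {a..b} x"
  shows "abs_cont_on {a..b} (\<lambda>t. x t \<bullet> (Q *v x t))"
proof -
  have "bounded (x ` {a..b})"
    by (intro compact_imp_bounded compact_continuous_image abs_cont_on_imp_continuous_on[OF x]) simp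
  then obtain M where M: "M > 0" "\<And>t. t \<in> {a..b} \<Longrightarrow> norm (x t) \<le> M"
    unfolding bounded_pos by blast
  obtain c where c: "c > 0" "\<And>v. norm (Q *v v) \<le> c * norm v"
    using linear_bounded_pos[OF matrix_vector_mul_linear] by blast
  show ?thesis
  proof (rule abs_cont_on_dominated[OF x, of "2 * M * c"])
    show "0 \<le> 2 * M * c" using M c by simp
    fix s t assume st: "s \<in> {a..b}" "t \<in> {a..b}"
    have le: "\<bar>v \<bullet> (Q *v w)\<bar> \<le> c * norm v * norm w" for v w
    proof -
      have "\<bar>v \<bullet> (Q *v w)\<bar> \<le> norm v * norm (Q *v w)" by (rule Cauchy_Schwarz_ineq2)
      also have "\<dots> \<le> norm v * (c * norm w)" by (intro mult_left_mono c) simp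
      finally show ?thesis by (simp add: mult_ac)
    qed
    have "x t \<bullet> (Q *v x t) - x s \<bullet> (Q *v x s) = (x t - x s) \<bullet> (Q *v x t) + x s \<bullet> (Q *v (x t - x s))"
      by (simp add: matrix_vector_mult_diff_distrib inner_diff_left inner_diff_right)
    also have "\<bar>\<dots>\<bar> \<le> c * norm (x t - x s) * norm (x t) + c * norm (x s) * norm (x t - x s)"
      using le by (meson abs_triangle_ineq add_mono order_trans)
    also have "\<dots> \<le> c * norm (x t - x s) * M + c * M * norm (x t - x s)"
      using M c st by (intro add_mono mult_left_mono mult_right_mono) auto
    finally show "norm (x t \<bullet> (Q *v x t) - x s \<bullet> (Q *v x s)) \<le> 2 * M * c * norm (x t - x s)"
      by (simp add: mult_ac)
  qed
qed

text \<open>Continuity of \<open>x\<close> and measurability of \<open>u\<close> give a measurable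
  integrand, dominated by a continuous function because \<open>u\<close> is bounded. The Lebesgue
  integral of the input term is thus a genuine value, not the default 0.\<close>

lemma absolutely_integrable_inner_bounded:
  fixes x :: "real \<Rightarrow> real ^ 'n" and u :: "real \<Rightarrow> real ^ 'm"
  assumes x: "continuous_on {a..b} x" and u: "set_borel_measurable lebesgue {a..b} u"
    and k: "\<And>t. t \<in> {a..b} \<Longrightarrow> norm (u t) \<le> k"
  shows "(\<lambda>t. x t \<bullet> (M *v u t)) absolutely_integrable_on {a..b}"
proof -
  have "u \<in> borel_measurable (lebesgue_on {a..b})"
    using u by (simp add: set_borel_measurable_def borel_measurable_restrict_space_iff)
  then have "(\<lambda>t. M *v u t) \<in> borel_measurable (lebesgue_on {a..b})"
    by (intro borel_measurable_continuous_on[where f = "(*v) M"] continuous_intros)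
  from borel_measurable_inner[OF continuous_imp_measurable_on_sets_lebesgue[OF x] this]
  have meas: "(\<lambda>t. x t \<bullet> (M *v u t)) \<in> borel_measurable (lebesgue_on {a..b})"
    by simp
  obtain c where c: "c > 0" "\<And>v. norm (M *v v) \<le> c * norm v"
    using linear_bounded_pos[OF matrix_vector_mul_linear] by blast
  show ?thesis
  proof (rule measurable_bounded_by_integrable_imp_absolutely_integrable[OF meas])
    show "(\<lambda>t. norm (x t) * (c * k)) integrable_on {a..b}"
      by (intro integrable_continuous_real continuous_intros x)
    fix t assume t: "t \<in> {a..b}"
    have "norm (M *v u t) \<le> c * k"
      using c(2)[of "u t"] k[OF t] \<open>c > 0\<close> by (meson mult_left_mono less_imp_le order_trans)
    then show "norm (x t \<bullet> (M *v u t)) \<le> norm (x t) * (c * k)"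
      by (metis real_norm_def Cauchy_Schwarz_ineq2 mult_left_mono norm_ge_zero order_trans)
  qed simp
qed

theorem mainTheorem4:
  fixes A :: "real ^ 'n ^ 'n"
    and N :: "'m::finite \<Rightarrow> real ^ 'n ^ 'n"
    and B :: "real ^ 'm ^ 'n"
    and C :: "real ^ 'n ^ 'p"
    and Q :: "real ^ 'n ^ 'n"
    and k T :: real
    and x0 :: "real ^ 'n"
    and u :: "real \<Rightarrow> real ^ 'm"
    and x :: "real \<Rightarrow> real ^ 'n"
    and y :: "real \<Rightarrow> real ^ 'p"
  assumes k_pos: "k > 0"
    and T_pos: "T > 0"
    and stable: "spectrum (mat 1 \<otimes>\<^sub>K (A + (k\<^sup>2 / 2) *\<^sub>R mat 1)
                           + (A + (k\<^sup>2 / 2) *\<^sub>R mat 1) \<otimes>\<^sub>K mat 1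
                           + (\<Sum>i\<in>UNIV. N i \<otimes>\<^sub>K N i)) \<subseteq> {z. Re z < 0}"
    and gramian: "transpose (A + (k\<^sup>2 / 2) *\<^sub>R mat 1) ** Q + Q ** (A + (k\<^sup>2 / 2) *\<^sub>R mat 1)
                    + (\<Sum>i\<in>UNIV. transpose (N i) ** Q ** N i) = - (transpose C ** C)"
    and control: "is_control T u"
    and control_bound: "\<forall>t\<in>{0..T}. norm (u t) \<le> k"
    and solution: "bilinear_solution A N B T x0 u x"
    and output_eq: "\<forall>t\<in>{0..T}. y t = C *v x t"
  shows "(LINT s:{0..T}|lebesgue. (norm (y s))\<^sup>2)
           \<le> x0 \<bullet> (Q *v x0) + 2 * (LINT s:{0..T}|lebesgue. x s \<bullet> (Q *v (B *v u s)))"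
proof -
  let ?A = "A + (k\<^sup>2 / 2) *\<^sub>R mat 1"
  have gram: "gen_lyapunov ?A N Q = - (transpose C ** C)"
    using gramian by (simp add: gen_lyapunov_def)
  \<comment> \<open>A nonzero \<open>X\<close> would put the number \<open>s\<close>, of nonnegative
    real part, into the spectrum.\<close>
  have inj: "X = 0" if "s \<ge> 0" "gen_lyapunov ?A N X = s *\<^sub>R X" for s X
    using gen_lyapunov_eigenvalue[OF that(2)] stable that(1) by fastforce
  have CC: "transpose (transpose C ** C) = transpose C ** C"
    "0 \<le> v \<bullet> ((transpose C ** C) *v v)" for v
    by (simp_all add: matrix_transpose_mul transpose_transpose inner_transpose_mult
        matrix_vector_mul_assoc[symmetric] del: transpose_matrix_vector)
  have sym: "transpose Q = Q"
    by (rule gen_lyapunov_solution_psd(1)[OF _ CC gram]) (rule inj)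
  have psd: "0 \<le> v \<bullet> (Q *v v)" for v
    by (rule gen_lyapunov_solution_psd(2)[OF _ CC gram]) (rule inj)
  have x0: "x 0 = x0" and ac: "abs_cont_on {0..T} x"
    using solution by (auto simp: bilinear_solution_def)
  have x_cont: "continuous_on {0..T} x"
    by (rule abs_cont_on_imp_continuous_on[OF ac])
  define F where "F t = A *v x t + B *v u t + (\<Sum>i\<in>UNIV. (u t $ i) *\<^sub>R (N i *v x t))" for t
  have V_int: "((\<lambda>t. 2 * (x t \<bullet> (Q *v F t))) has_integral (x T \<bullet> (Q *v x T) - x 0 \<bullet> (Q *v x 0))) {0..T}"
  proof (rule fundamental_theorem_of_calculus_abs_cont[OF _ abs_cont_on_quadratic_form[OF ac]])
    have "((\<lambda>t. x t \<bullet> (Q *v x t)) has_vector_derivative 2 * (x t \<bullet> (Q *v F t))) (at t within {0..T})"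
      if "(x has_vector_derivative F t) (at t within {0..T})" for t
    proof -
      have "((\<lambda>t. Q *v x t) has_vector_derivative Q *v F t) (at t within {0..T})"
        using bounded_linear.has_vector_derivative[OF matrix_vector_mul_bounded_linear that] .
      \<comment> \<open>The product rule gives two terms, which agree because \<open>Q\<close> is
        symmetric.\<close>
      from bounded_bilinear.has_vector_derivative[OF bounded_bilinear_inner that this]
      show ?thesis
        using inner_transpose_mult[of "x t" Q "F t"]
        by (simp only: sym inner_commute mult_2)
    qed
    then show "AE t in lebesgue. t \<in> {0..T} \<longrightarrow>
        ((\<lambda>t. x t \<bullet> (Q *v x t)) has_vector_derivative 2 * (x t \<bullet> (Q *v F t))) (at t within {0..T})"
      using solution unfolding bilinear_solution_def F_def[symmetric] by (auto elim!: AE_mp)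
  qed (use T_pos in simp)
  have y_eq: "(LINT s:{0..T}|lebesgue. (norm (y s))\<^sup>2)
      = (LINT s:{0..T}|lebesgue. (norm (C *v x s))\<^sup>2)"
    using output_eq by (intro set_lebesgue_integral_cong) auto
  have "(\<lambda>t. (norm (C *v x t))\<^sup>2) absolutely_integrable_on {0..T}"
    by (intro absolutely_integrable_continuous_real continuous_intros
        continuous_on_compose2[OF matrix_vector_mult_linear_continuous_on x_cont]) auto
  then have y_int: "((\<lambda>t. (norm (C *v x t))\<^sup>2) has_integral (LINT s:{0..T}|lebesgue. (norm (y s))\<^sup>2)) {0..T}"
    unfolding y_eq by (rule has_integral_set_lebesgue)
  have "(\<lambda>t. x t \<bullet> (Q *v (B *v u t))) absolutely_integrable_on {0..T}"
    using absolutely_integrable_inner_bounded[OF x_cont, of u k "Q ** B"] control control_bound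
    by (simp add: is_control_def matrix_vector_mul_assoc)
  then have u_int: "((\<lambda>t. x t \<bullet> (Q *v (B *v u t))) has_integral
      (LINT s:{0..T}|lebesgue. x s \<bullet> (Q *v (B *v u s)))) {0..T}"
    by (rule has_integral_set_lebesgue)
  have "x T \<bullet> (Q *v x T) - x 0 \<bullet> (Q *v x 0)
      \<le> 2 * (LINT s:{0..T}|lebesgue. x s \<bullet> (Q *v (B *v u s))) - (LINT s:{0..T}|lebesgue. (norm (y s))\<^sup>2)"
  \<comment> \<open>The integrands are compared at every point of \<open>{0..T}\<close>:
    \<open>F\<close> is the right-hand side of the equation itself, so exceptional times for the
    derivative of \<open>x\<close> do not matter here.\<close>
  proof (rule has_integral_le[OF V_int has_integral_diff[OF has_integral_mult_right[OF u_int] y_int]])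
    show "2 * (x t \<bullet> (Q *v F t)) \<le> 2 * (x t \<bullet> (Q *v (B *v u t))) - (norm (C *v x t))\<^sup>2"
      if "t \<in> {0..T}" for t
      unfolding F_def using dissipation_inequality[OF sym psd gram] control_bound that by blast
  qed
  then show ?thesis using psd[of "x T"] by (simp add: x0)
qed

end
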